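(* Let $A\subset B$ and $B\subset C$ be two integral ring extensions of integral domains. Suppose that $A$ is integrally closed (in its field of fractions). Then $$\mathrm{d}_A(C)\leq \mathrm{d}_A(B)\,\mathrm{d}_B(C).$$
   Context: All rings are commutative with unity. For an integral ring extension $A\subset B$ of integral domains and $b\in B$, the integral degree of $b$ over $A$, denoted $\mathrm{id}_A(b)$, is the minimum integer $n\geq 1$ such that $b$ is a root of a monic polynomial of degree $n$ in $A[T]$. The integral degree of $B$ over $A$ is $\mathrm{d}_A(B)=\sup\{\mathrm{id}_A(b)\mid b\in B\}$ (possibly $\infty$). *)

theory Defs
  imports
    "HOL-Computational_Algebra.Polynomial_Factorial"
    "HOL-Library.Extended_Nat"
begin

text \<open>
  The integral domains under consideration are unital subrings of an ambient integral domain,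
  given by the type; polynomials over a subring \<open>A\<close> are polynomials over the ambient
  ring all of whose coefficients lie in \<open>A\<close>.
\<close>

definition unital_subring :: "'a::comm_ring_1 set \<Rightarrow> bool" where
  "unital_subring A \<longleftrightarrow>
     1 \<in> A \<and> (\<forall>x\<in>A. \<forall>y\<in>A. x - y \<in> A \<and> x * y \<in> A)"

definition polys_over :: "'a::comm_ring_1 set \<Rightarrow> 'a poly set" where
  "polys_over A = {p. \<forall>i. coeff p i \<in> A}"

definition integral_over :: "'a::comm_ring_1 set \<Rightarrow> 'a \<Rightarrow> bool" where
  "integral_over A b \<longleftrightarrow> (\<exists>p\<in>polys_over A. lead_coeff p = 1 \<and> poly p b = 0)"

definition integral_extension :: "'a::comm_ring_1 set \<Rightarrow> 'a set \<Rightarrow> bool" where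
  "integral_extension A B \<longleftrightarrow>
     unital_subring A \<and> unital_subring B \<and> A \<subseteq> B \<and> (\<forall>b\<in>B. integral_over A b)"

text \<open>The field of fractions of \<open>A\<close>, as a subfield of that of the ambient integral domain.\<close>

definition fraction_field :: "'a::idom set \<Rightarrow> 'a fract set" where
  "fraction_field A = {Fract a s | a s. a \<in> A \<and> s \<in> A \<and> s \<noteq> 0}"

definition integrally_closed :: "'a::idom set \<Rightarrow> bool" where
  "integrally_closed A \<longleftrightarrow>
     (\<forall>x\<in>fraction_field A. integral_over (to_fract ` A) x \<longrightarrow> x \<in> to_fract ` A)"

text \<open>Only meaningful when \<open>b\<close> is integral over \<open>A\<close>.\<close>

definition integral_degree :: "'a::comm_ring_1 set \<Rightarrow> 'a \<Rightarrow> nat" where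
  "integral_degree A b =
     (LEAST n. n \<ge> 1 \<and>
        (\<exists>p\<in>polys_over A. lead_coeff p = 1 \<and> degree p = n \<and> poly p b = 0))"

definition ext_degree :: "'a::comm_ring_1 set \<Rightarrow> 'a set \<Rightarrow> enat" where
  "ext_degree A B = (SUP b\<in>B. enat (integral_degree A b))"

end

theory Submission
  imports
    "HOL-Algebra.Multiplicative_Group"
    "HOL-Algebra.Algebraic_Closure_Type"
    "Jordan_Normal_Form.Char_Poly"
    Defs
begin

text \<open>
  Let \<open>w\<close> be a monic polynomial of degree \<open>n\<close> over \<open>B\<close> with root \<open>c\<close>, and let all elements of \<open>B\<close>
  have integral degree at most \<open>d\<close> over \<open>A\<close>. As \<open>A\<close> is integrally closed, it suffices to find some
  nonzero polynomial over \<open>A\<close> of degree at most \<open>n * d\<close> that annihilates \<open>c\<close>: a polynomial of minimal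
  degree annihilating \<open>c\<close> is then a scalar multiple of a monic polynomial over \<open>A\<close>.

  If \<open>A\<close> is infinite, look for a relation \<open>(\<Sum>i\<le>n * d. \<Sum>j\<le>J. a i j * T ^ i * w ^ j) = 0\<close> with
  coefficients in \<open>A\<close>. Its left-hand side has degree at most \<open>n * d + n * J\<close>, so it is enough that it
  vanishes at \<open>n * d + n * J + 1\<close> points \<open>t\<close> of \<open>A\<close>. The powers of \<open>w(t) \<in> B\<close> are combinations over \<open>A\<close>
  of the first \<open>d\<close> ones, so each point costs only \<open>d\<close> linear equations, and for large \<open>J\<close> there
  are fewer equations than unknowns. After cancelling powers of \<open>w\<close>, evaluating at \<open>c\<close>
  gives the required polynomial. This avoids any distinction between
  separable and inseparable extensions.

  If \<open>A\<close> is finite with \<open>q\<close> elements, the coefficients of \<open>w\<close> generate a finite field \<open>E\<close> over \<open>A\<close>.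
  Its unit group is cyclic, so \<open>E\<close> is generated by one element and has at most \<open>q ^ d\<close> elements.
  Hence \<open>E[c]\<close> has at most \<open>q ^ (n * d)\<close> elements, fewer than there are polynomials over \<open>A\<close> of
  degree at most \<open>n * d\<close>.
\<close>

subsection \<open>Unital subrings and polynomials over them\<close>

context
  fixes S :: "'a::comm_ring_1 set"
  assumes S: "unital_subring S"
begin

lemma unital_subring_1: "1 \<in> S"
  using S by (auto simp: unital_subring_def)

lemma unital_subring_diff: "x \<in> S \<Longrightarrow> y \<in> S \<Longrightarrow> x - y \<in> S"
  using S by (auto simp: unital_subring_def)

lemma unital_subring_mult: "x \<in> S \<Longrightarrow> y \<in> S \<Longrightarrow> x * y \<in> S"
  using S by (auto simp: unital_subring_def)

lemma unital_subring_0: "0 \<in> S"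
  using unital_subring_diff[OF unital_subring_1 unital_subring_1] by simp

lemma unital_subring_uminus: "x \<in> S \<Longrightarrow> - x \<in> S"
  using unital_subring_diff[OF unital_subring_0] by fastforce

lemma unital_subring_add: "x \<in> S \<Longrightarrow> y \<in> S \<Longrightarrow> x + y \<in> S"
  using unital_subring_diff[OF _ unital_subring_uminus] by fastforce

lemma unital_subring_sum: "(\<And>i. i \<in> I \<Longrightarrow> f i \<in> S) \<Longrightarrow> sum f I \<in> S"
  by (induction I rule: infinite_finite_induct) (auto intro: unital_subring_0 unital_subring_add)

lemma unital_subring_prod: "(\<And>i. i \<in> I \<Longrightarrow> f i \<in> S) \<Longrightarrow> prod f I \<in> S"
  by (induction I rule: infinite_finite_induct) (auto intro: unital_subring_1 unital_subring_mult)

lemma unital_subring_power: "x \<in> S \<Longrightarrow> x ^ n \<in> S"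
  by (induction n) (auto intro: unital_subring_1 unital_subring_mult)

lemma unital_subring_of_nat: "of_nat n \<in> S"
  by (induction n) (auto intro: unital_subring_0 unital_subring_1 unital_subring_add)

lemma unital_subring_of_int: "of_int k \<in> S"
  by (cases k rule: int_diff_cases) (auto intro: unital_subring_of_nat unital_subring_diff)

lemmas unital_subring_closed =
  unital_subring_0 unital_subring_1 unital_subring_add unital_subring_diff unital_subring_uminus
  unital_subring_mult unital_subring_sum unital_subring_prod unital_subring_power
  unital_subring_of_int

lemma unital_subring_polys_over: "unital_subring (polys_over S)"
  unfolding unital_subring_def polys_over_def
  by (auto simp: coeff_mult coeff_1 intro!: unital_subring_closed)

lemma monom_polys_over: "a \<in> S \<Longrightarrow> Polynomial.monom a i \<in> polys_over S"
  by (auto simp: polys_over_def intro: unital_subring_closed)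

lemma smult_polys_over: "a \<in> S \<Longrightarrow> p \<in> polys_over S \<Longrightarrow> smult a p \<in> polys_over S"
  by (auto simp: polys_over_def intro: unital_subring_closed)

lemma pCons_polys_over: "a \<in> S \<Longrightarrow> p \<in> polys_over S \<Longrightarrow> pCons a p \<in> polys_over S"
  by (auto simp: polys_over_def coeff_pCons split: nat.split)

lemma poly_mem_unital_subring: "p \<in> polys_over S \<Longrightarrow> x \<in> S \<Longrightarrow> poly p x \<in> S"
  by (auto simp: poly_altdef polys_over_def intro!: unital_subring_closed)

text \<open>Long division in which \<open>f\<close> is scaled by the leading coefficient of
  \<open>g\<close> before each subtraction, so that no coefficient leaves \<open>S\<close>;
  \<open>k\<close> counts the scalings. For monic \<open>g\<close> it is ordinary division with
  remainder.\<close>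

lemma pseudo_division_polys_over:
  assumes g: "g \<in> polys_over S" "g \<noteq> 0" and f: "f \<in> polys_over S"
  shows "\<exists>k. \<exists>q\<in>polys_over S. \<exists>r\<in>polys_over S.
    smult (lead_coeff g ^ k) f = g * q + r \<and> (r = 0 \<or> degree r < degree g)"
  using f
proof (induction "degree f" arbitrary: f rule: less_induct)
  case less
  note P = unital_subring_polys_over
  \<comment> \<open>Nonzero constants need a case of their own: there the degree cannot drop any
    further, so the induction hypothesis would not apply.\<close>
  consider "f = 0 \<or> degree f < degree g" | "f \<noteq> 0" "degree g = 0" "degree f = 0"
    | "degree g \<le> degree f" "degree f > 0" by linarith
  then show ?case
  proof cases
    case 1
    then show ?thesis
      using less.prems f g by (intro exI[of _ 0] bexI[of _ 0] bexI[of _ f])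
        (auto simp: polys_over_def unital_subring_0)
  next
    case 2
    then obtain a b where "f = [:a:]" "g = [:b:]"
      by (metis degree_eq_zeroE)
    with less.prems g(2) show ?thesis
      by (intro exI[of _ 1] bexI[of _ f] bexI[of _ 0])
        (auto simp: polys_over_def unital_subring_0)
  next
    case 3
    define h where "h = smult (lead_coeff g) f - Polynomial.monom (lead_coeff f) (degree f - degree g) * g"
    have lc: "lead_coeff g \<in> S" "lead_coeff f \<in> S"
      using g less.prems by (auto simp: polys_over_def)
    have mem: "Polynomial.monom (lead_coeff f) (degree f - degree g) \<in> polys_over S"
      using lc monom_polys_over by blast
    have h: "h \<in> polys_over S"
      unfolding h_def using lc less.prems g mem P smult_polys_over
      by (auto simp: unital_subring_def)
    have "degree h \<le> degree f"
      unfolding h_def using 3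
      by (intro degree_diff_le order_trans[OF degree_mult_le])
        (auto intro: order_trans[OF degree_smult_le]
          simp: order_trans[OF add_right_mono[OF degree_monom_le]])
    moreover have "coeff h (degree f) = 0"
      using 3 by (simp add: h_def coeff_monom_mult)
    ultimately have "degree h < degree f"
      using 3 by (metis le_neq_implies_less leading_coeff_0_iff degree_0)
    from less.hyps[OF this h] obtain k q r where *: "q \<in> polys_over S" "r \<in> polys_over S"
      "smult (lead_coeff g ^ k) h = g * q + r" "r = 0 \<or> degree r < degree g" by blast
    define q' where "q' = q + smult (lead_coeff g ^ k) (Polynomial.monom (lead_coeff f) (degree f - degree g))"
    have "smult (lead_coeff g ^ Suc k) f = smult (lead_coeff g ^ k) h
        + smult (lead_coeff g ^ k) (Polynomial.monom (lead_coeff f) (degree f - degree g)) * g"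
      by (simp add: h_def smult_diff_right mult.commute)
    also have "\<dots> = g * q' + r"
      unfolding *(3) q'_def by (simp add: algebra_simps)
    finally have "smult (lead_coeff g ^ Suc k) f = g * q' + r" .
    moreover have "q' \<in> polys_over S"
      unfolding q'_def using *(1) mem lc(1) P
      by (auto simp: polys_over_def intro!: unital_subring_add unital_subring_mult unital_subring_power
          simp del: coeff_monom)
    ultimately show ?thesis
      using * by blast
  qed
qed

end

lemma unital_subring_det:
  assumes S: "unital_subring S" and M: "M \<in> carrier_mat n n"
    and mem: "\<And>i j. i < n \<Longrightarrow> j < n \<Longrightarrow> M $$ (i, j) \<in> S"
  shows "det M \<in> S"
  unfolding det_def'[OF M]
  by (intro unital_subring_closed[OF S] mem) (auto simp: permutes_in_image)

subsection \<open>Annihilating polynomials over infinite rings\<close>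

text \<open>Gaussian elimination without division: an equation with a nonzero coefficient is used to
  eliminate one unknown from the others by cross-multiplication, which keeps all entries in
  \<open>A\<close>.\<close>

lemma underdetermined_system:
  fixes A :: "'a::idom set" and M :: "'e \<Rightarrow> 'i \<Rightarrow> 'a"
  assumes A: "unital_subring A" and "finite E" "finite I" "card E < card I"
    and M: "\<And>e i. e \<in> E \<Longrightarrow> i \<in> I \<Longrightarrow> M e i \<in> A"
  shows "\<exists>a. (\<forall>i\<in>I. a i \<in> A) \<and> (\<exists>i\<in>I. a i \<noteq> 0) \<and> (\<forall>e\<in>E. (\<Sum>i\<in>I. M e i * a i) = 0)"
  using assms(2-)
proof (induction E arbitrary: I M rule: finite_induct)
  case empty
  then show ?case
    using unital_subring_1[OF A] by (intro exI[of _ "\<lambda>_. 1"]) (auto simp: card_gt_0_iff)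
next
  case (insert e E)
  show ?case
  proof (cases "\<forall>i\<in>I. M e i = 0")
    case True
    with insert.IH[of I M] insert.prems insert.hyps show ?thesis by auto
  next
    case False
    then obtain k where k: "k \<in> I" "M e k \<noteq> 0" by auto
    define N where "N e' i = M e k * M e' i - M e' k * M e i" for e' i
    have "\<exists>a. (\<forall>i\<in>I - {k}. a i \<in> A) \<and> (\<exists>i\<in>I - {k}. a i \<noteq> 0) \<and>
        (\<forall>e'\<in>E. (\<Sum>i\<in>I - {k}. N e' i * a i) = 0)"
      using insert.prems insert.hyps k
      by (intro insert.IH) (auto simp: N_def intro!: unital_subring_closed[OF A])
    then obtain a where a: "\<forall>i\<in>I - {k}. a i \<in> A" "\<exists>i\<in>I - {k}. a i \<noteq> 0"
      "\<forall>e'\<in>E. (\<Sum>i\<in>I - {k}. N e' i * a i) = 0" by blast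
    \<comment> \<open>Solving row \<open>e\<close> for unknown \<open>k\<close> would require
      division by \<open>M e k\<close>, so the other unknowns are scaled by it instead. Row
      \<open>e\<close> is then satisfied because \<open>N e i = 0\<close>.\<close>
    define b where "b i = (if i = k then - (\<Sum>i\<in>I - {k}. M e i * a i) else M e k * a i)" for i
    have sum_b: "(\<Sum>i\<in>I. M e' i * b i) = (\<Sum>i\<in>I - {k}. N e' i * a i)" for e'
    proof -
      have "(\<Sum>i\<in>I. M e' i * b i) = M e' k * b k + (\<Sum>i\<in>I - {k}. M e' i * b i)"
        using insert.prems k by (simp add: sum.remove)
      also have "(\<Sum>i\<in>I - {k}. M e' i * b i) = (\<Sum>i\<in>I - {k}. M e k * M e' i * a i)"
        by (intro sum.cong) (auto simp: b_def)
      finally show ?thesis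
        by (simp add: b_def N_def sum_distrib_left sum_subtractf algebra_simps)
    qed
    have "\<forall>i\<in>I. b i \<in> A"
      using a k insert.prems by (auto simp: b_def intro!: unital_subring_closed[OF A])
    moreover have "\<exists>i\<in>I. b i \<noteq> 0"
      using a(2) k by (auto simp: b_def)
    moreover have "\<forall>e'\<in>insert e E. (\<Sum>i\<in>I. M e' i * b i) = 0"
      using a(3) by (auto simp: sum_b) (simp add: N_def mult.commute)
    ultimately show ?thesis by blast
  qed
qed

text \<open>At \<open>c\<close> every term with \<open>j > 0\<close> vanishes, so \<open>p 0\<close>
  has root \<open>c\<close>. If \<open>p 0\<close> is the zero polynomial, a factor \<open>w\<close>
  cancels and the argument repeats; it stops at the first nonzero \<open>p j\<close>.\<close>

lemma factor_out_root:
  fixes w :: "'a::idom poly"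
  assumes "w \<noteq> 0" "poly w c = 0" "(\<Sum>j\<le>J. p j * w ^ j) = 0" "\<exists>j\<le>J. p j \<noteq> 0"
  shows "\<exists>j\<le>J. p j \<noteq> 0 \<and> poly (p j) c = 0"
  using assms(3,4)
proof (induction J arbitrary: p)
  case 0
  then show ?case by simp
next
  case (Suc J)
  have eq: "p 0 + w * (\<Sum>j\<le>J. p (Suc j) * w ^ j) = 0"
    using Suc.prems(1) by (simp add: sum.atMost_Suc_shift sum_distrib_left mult_ac del: sum.atMost_Suc)
  show ?case
  proof (cases "p 0 = 0")
    case True
    with eq assms have "(\<Sum>j\<le>J. p (Suc j) * w ^ j) = 0" by simp
    moreover have "\<exists>j\<le>J. p (Suc j) \<noteq> 0"
      using Suc.prems(2) True by (metis Suc_le_mono not0_implies_Suc)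
    ultimately show ?thesis
      using Suc.IH[of "\<lambda>j. p (Suc j)"] by auto
  next
    case False
    from arg_cong[OF eq, of "\<lambda>q. poly q c"] assms(2) have "poly (p 0) c = 0" by simp
    with False show ?thesis by blast
  qed
qed

lemma poly_eq_sum_lessThan:
  fixes p :: "'a::comm_semiring_1 poly"
  assumes "p = 0 \<or> degree p < d"
  shows "poly p x = (\<Sum>k<d. coeff p k * x ^ k)"
proof -
  have "(\<Sum>k\<le>degree p. coeff p k * x ^ k) = (\<Sum>k<d. coeff p k * x ^ k)" if "degree p < d"
    using that by (intro sum.mono_neutral_left) (auto simp: coeff_eq_0)
  with assms show ?thesis by (auto simp: poly_altdef)
qed

lemma reduce_modulo_monic:
  assumes S: "unital_subring S" and g: "g \<in> polys_over S" "lead_coeff g = 1" "poly g x = 0"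
    and f: "f \<in> polys_over S"
  obtains r where "r \<in> polys_over S" "r = 0 \<or> degree r < degree g" "poly r x = poly f x"
proof -
  have "g \<noteq> 0" using g by auto
  from pseudo_division_polys_over[OF S g(1) this f] g(2)
  obtain q r where "r \<in> polys_over S" "f = g * q + r" "r = 0 \<or> degree r < degree g" by auto
  with that[of r] g(3) show ?thesis by auto
qed

lemma annihilator_infinite:
  fixes w :: "'a::idom poly"
  assumes A: "unital_subring A" and inf: "infinite A"
    and w: "w \<noteq> 0" "degree w = n" "poly w c = 0"
    and d: "\<And>t. t \<in> A \<Longrightarrow>
      \<exists>g\<in>polys_over A. lead_coeff g = 1 \<and> degree g \<le> d \<and> poly g (poly w t) = 0"
  shows "\<exists>p\<in>polys_over A. p \<noteq> 0 \<and> degree p \<le> n * d \<and> poly p c = 0"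
proof -
  \<comment> \<open>There will be \<open>(D + n * J + 1) * d\<close> equations and
    \<open>(D + 1) * (J + 1)\<close> unknowns. Both counts contain \<open>n * d * J\<close>; what
    remains is \<open>n * d * d + d\<close> against \<open>n * d + J + 1\<close>, so this
    \<open>J\<close> suffices.\<close>
  define D J where "D = n * d" and "J = n * d * d + d"
  define L where "L = D + n * J"
  obtain P where P: "finite P" "P \<subseteq> A" "card P = L + 1"
    using infinite_arbitrarily_large[OF inf] by metis
  have "\<exists>r\<in>polys_over A. (r = 0 \<or> degree r < d) \<and> poly r (poly w t) = poly w t ^ j"
    if t: "t \<in> P" for t j
  proof -
    obtain g where g: "g \<in> polys_over A" "lead_coeff g = 1" "degree g \<le> d" "poly g (poly w t) = 0"
      using d[of t] t P by blast
    obtain r where "r \<in> polys_over A" "r = 0 \<or> degree r < degree g"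
      "poly r (poly w t) = poly (Polynomial.monom 1 j) (poly w t)"
      by (rule reduce_modulo_monic[OF A g(1,2,4) monom_polys_over[OF A unital_subring_1[OF A]]])
    with g(3) show ?thesis by (intro bexI[of _ r]) (auto simp: poly_monom)
  qed
  then obtain r where r: "\<And>t j. t \<in> P \<Longrightarrow> r t j \<in> polys_over A"
    "\<And>t j. t \<in> P \<Longrightarrow> r t j = 0 \<or> degree (r t j) < d"
    "\<And>t j. t \<in> P \<Longrightarrow> poly (r t j) (poly w t) = poly w t ^ j"
    by metis
  \<comment> \<open>Equation \<open>(t, k)\<close> says that the coefficient of
    \<open>poly w t ^ k\<close> in the value of the relation at \<open>t\<close> vanishes. These
    powers may be linearly dependent; only the sufficiency of the equations is used.\<close>
  define M where "M = (\<lambda>(t, k) (i, j). t ^ i * coeff (r t j) k)"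
  have "\<exists>a. (\<forall>i\<in>{..D} \<times> {..J}. a i \<in> A) \<and> (\<exists>i\<in>{..D} \<times> {..J}. a i \<noteq> 0) \<and>
      (\<forall>e\<in>P \<times> {..<d}. (\<Sum>i\<in>{..D} \<times> {..J}. M e i * a i) = 0)"
  proof (intro underdetermined_system A)
    show "card (P \<times> {..<d}) < card ({..D} \<times> {..J})"
      by (simp add: P L_def D_def J_def algebra_simps)
    fix e i assume "e \<in> P \<times> {..<d}" "i \<in> {..D} \<times> {..J}"
    then show "M e i \<in> A"
      using r(1) P(2) by (auto simp: M_def polys_over_def intro!: unital_subring_closed[OF A])
  qed (use P in auto)
  then obtain a where a: "\<And>i j. i \<le> D \<Longrightarrow> j \<le> J \<Longrightarrow> a (i, j) \<in> A"
    "\<exists>i\<le>D. \<exists>j\<le>J. a (i, j) \<noteq> 0"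
    "\<And>t k. t \<in> P \<Longrightarrow> k < d \<Longrightarrow> (\<Sum>i\<le>D. \<Sum>j\<le>J. t ^ i * coeff (r t j) k * a (i, j)) = 0"
    by (fastforce simp: M_def sum.cartesian_product split_def)
  define p where "p j = (\<Sum>i\<le>D. Polynomial.monom (a (i, j)) i)" for j
  define h where "h = (\<Sum>j\<le>J. p j * w ^ j)"
  have coeff_p: "coeff (p j) i = (if i \<le> D then a (i, j) else 0)" for i j
    by (simp add: p_def coeff_sum)
  have deg_p: "degree (p j) \<le> D" for j
    by (intro degree_le) (auto simp: coeff_p)
  have p_mem: "p j \<in> polys_over A" if "j \<le> J" for j
    using a(1) that unital_subring_0[OF A] by (auto simp: polys_over_def coeff_p)
  have "poly h t = 0" if t: "t \<in> P" for t
  proof -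
    have "poly h t = (\<Sum>j\<le>J. (\<Sum>i\<le>D. a (i, j) * t ^ i) * (\<Sum>k<d. coeff (r t j) k * poly w t ^ k))"
      using r(3)[OF t] poly_eq_sum_lessThan[OF r(2)[OF t], where x = "poly w t"]
      by (simp add: h_def p_def poly_sum poly_monom)
    also have "\<dots> = (\<Sum>j\<le>J. \<Sum>i\<le>D. \<Sum>k<d. poly w t ^ k * (t ^ i * coeff (r t j) k * a (i, j)))"
      by (simp add: sum_product mult_ac)
    also have "\<dots> = (\<Sum>i\<le>D. \<Sum>j\<le>J. \<Sum>k<d. poly w t ^ k * (t ^ i * coeff (r t j) k * a (i, j)))"
      by (rule sum.swap)
    also have "\<dots> = (\<Sum>i\<le>D. \<Sum>k<d. \<Sum>j\<le>J. poly w t ^ k * (t ^ i * coeff (r t j) k * a (i, j)))"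
      by (rule sum.cong[OF refl], rule sum.swap)
    also have "\<dots> = (\<Sum>k<d. \<Sum>i\<le>D. \<Sum>j\<le>J. poly w t ^ k * (t ^ i * coeff (r t j) k * a (i, j)))"
      by (rule sum.swap)
    also have "\<dots> = (\<Sum>k<d. poly w t ^ k * (\<Sum>i\<le>D. \<Sum>j\<le>J. t ^ i * coeff (r t j) k * a (i, j)))"
      by (simp add: sum_distrib_left)
    also have "\<dots> = 0"
      using a(3)[OF t] by simp
    finally show ?thesis .
  qed
  moreover have "degree h \<le> L"
    unfolding h_def
  proof (intro degree_sum_le)
    fix j assume "j \<in> {..J}"
    then have "degree (w ^ j) \<le> n * J"
      using w(2) by (metis atMost_iff degree_power_le mult_le_mono2 order_trans)
    with deg_p[of j] show "degree (p j * w ^ j) \<le> L"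
      unfolding L_def by (intro order_trans[OF degree_mult_le] add_mono)
  qed auto
  \<comment> \<open>The degree of \<open>h\<close> is at most \<open>L\<close>, but \<open>h\<close>
    vanishes at the \<open>L + 1\<close> points of \<open>P\<close>.\<close>
  ultimately have "h = 0"
    using P by (intro poly_eqI_degree[of P]) auto
  moreover have "\<exists>j\<le>J. p j \<noteq> 0"
    using a(2) coeff_p by (metis coeff_0)
  ultimately obtain j where "j \<le> J" "p j \<noteq> 0" "poly (p j) c = 0"
    using factor_out_root[of w c p J] w unfolding h_def by blast
  with p_mem deg_p show ?thesis
    unfolding D_def by blast
qed

subsection \<open>Integrality and module-finite extensions\<close>

definition adjoin :: "'a::comm_ring_1 set \<Rightarrow> 'a \<Rightarrow> 'a set" where
  "adjoin S x = (\<lambda>p. poly p x) ` polys_over S"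

lemma adjoin_subring:
  assumes S: "unital_subring S"
  shows "unital_subring (adjoin S x)"
proof -
  have "poly p x - poly q x \<in> adjoin S x" "poly p x * poly q x \<in> adjoin S x"
    if "p \<in> polys_over S" "q \<in> polys_over S" for p q
    using that unital_subring_polys_over[OF S] unfolding adjoin_def
    by (auto intro: image_eqI[of _ _ "p - q"] image_eqI[of _ _ "p * q"]
        unital_subring_diff unital_subring_mult)
  moreover have "1 \<in> adjoin S x"
    unfolding adjoin_def using unital_subring_1[OF unital_subring_polys_over[OF S]]
    by (intro image_eqI[of _ _ 1]) auto
  ultimately show ?thesis
    unfolding unital_subring_def by (auto simp: adjoin_def)
qed

lemma subset_adjoin:
  assumes "unital_subring S"
  shows "S \<subseteq> adjoin S x"
proof
  fix a assume "a \<in> S"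
  then show "a \<in> adjoin S x"
    unfolding adjoin_def using unital_subring_0[OF assms]
    by (intro image_eqI[of _ _ "[:a:]"]) (auto simp: polys_over_def coeff_pCons split: nat.split)
qed

lemma mem_adjoin:
  assumes "unital_subring S"
  shows "x \<in> adjoin S x"
  unfolding adjoin_def using unital_subring_closed[OF assms]
  by (intro image_eqI[of _ _ "[:0, 1:]"]) (auto simp: polys_over_def coeff_pCons split: nat.split)

lemma adjoin_subset:
  assumes "unital_subring B" "S \<subseteq> B" "x \<in> B"
  shows "adjoin S x \<subseteq> B"
  using assms poly_mem_unital_subring[OF assms(1)] unfolding adjoin_def polys_over_def by blast

text \<open>Reduction modulo \<open>g\<close>, with coefficients padded by zeros up to the bound
  \<open>d\<close>.\<close>

lemma adjoin_eq_combinations: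
  assumes S: "unital_subring S" and g: "g \<in> polys_over S" "lead_coeff g = 1" "degree g \<le> d" "poly g x = 0"
    and y: "y \<in> adjoin S x"
  obtains a where "\<And>k. a k \<in> S" "y = (\<Sum>k<d. a k * x ^ k)"
proof -
  obtain f where f: "f \<in> polys_over S" "y = poly f x" using y by (auto simp: adjoin_def)
  obtain r where r: "r \<in> polys_over S" "r = 0 \<or> degree r < degree g" "poly r x = poly f x"
    using reduce_modulo_monic[OF S g(1,2,4) f(1)] .
  from r(2) g(3) have "r = 0 \<or> degree r < d" by linarith
  from poly_eq_sum_lessThan[OF this] r f that[of "coeff r"] show ?thesis
    by (auto simp: polys_over_def)
qed

definition module_finite :: "'a::comm_ring_1 set \<Rightarrow> 'a set \<Rightarrow> bool" where
  "module_finite A S \<longleftrightarrow> (\<exists>G. finite G \<and> G \<subseteq> S \<and>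
     (\<forall>s\<in>S. \<exists>a. (\<forall>g\<in>G. a g \<in> A) \<and> s = (\<Sum>g\<in>G. a g * g)))"

text \<open>Allows generators to be given as a family with possible repetitions: coefficients
  belonging to equal generators are added up.\<close>

lemma module_finiteI:
  assumes A: "unital_subring A" and "finite J" "v ` J \<subseteq> S"
    and gen: "\<And>s. s \<in> S \<Longrightarrow> \<exists>a. (\<forall>j\<in>J. a j \<in> A) \<and> s = (\<Sum>j\<in>J. a j * v j)"
  shows "module_finite A S"
  unfolding module_finite_def
proof (intro exI[of _ "v ` J"] conjI ballI)
  fix s assume "s \<in> S"
  then obtain a where a: "\<forall>j\<in>J. a j \<in> A" "s = (\<Sum>j\<in>J. a j * v j)" using gen by blast
  show "\<exists>b. (\<forall>g\<in>v ` J. b g \<in> A) \<and> s = (\<Sum>g\<in>v ` J. b g * g)"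
  proof (intro exI[of _ "\<lambda>g. \<Sum>j\<in>{j \<in> J. v j = g}. a j"] conjI ballI)
    have "s = (\<Sum>g\<in>v ` J. \<Sum>j\<in>{j \<in> J. v j = g}. a j * v j)"
      unfolding a(2) by (rule sum.image_gen) fact
    also have "\<dots> = (\<Sum>g\<in>v ` J. (\<Sum>j\<in>{j \<in> J. v j = g}. a j) * g)"
      by (intro sum.cong) (auto simp: sum_distrib_right)
    finally show "s = \<dots>" .
  qed (use a in \<open>auto intro!: unital_subring_sum[OF A]\<close>)
qed (use assms in auto)

text \<open>The products of generators of \<open>S\<close> with the powers of \<open>x\<close> below
  the degree of a monic equation generate the larger ring.\<close>

lemma module_finite_adjoin:
  assumes A: "unital_subring A" and S: "unital_subring S" and fin: "module_finite A S"
    and x: "integral_over S x"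
  shows "module_finite A (adjoin S x)"
proof -
  obtain G where G: "finite G" "G \<subseteq> S"
    "\<And>s. s \<in> S \<Longrightarrow> \<exists>a. (\<forall>g\<in>G. a g \<in> A) \<and> s = (\<Sum>g\<in>G. a g * g)"
    using fin unfolding module_finite_def by blast
  obtain f where f: "f \<in> polys_over S" "lead_coeff f = 1" "poly f x = 0"
    using x unfolding integral_over_def by blast
  show ?thesis
  proof (rule module_finiteI[OF A, of "G \<times> {..<degree f}" "\<lambda>(g, i). g * x ^ i"])
    show "finite (G \<times> {..<degree f})" using G by simp
    show "(\<lambda>(g, i). g * x ^ i) ` (G \<times> {..<degree f}) \<subseteq> adjoin S x"
      using G(2) subset_adjoin[OF S, of x] mem_adjoin[OF S, of x]
      by (auto intro!: unital_subring_mult unital_subring_power adjoin_subring S)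
    fix y assume "y \<in> adjoin S x"
    then obtain b where b: "\<And>k. b k \<in> S" "y = (\<Sum>k<degree f. b k * x ^ k)"
      using adjoin_eq_combinations[OF S f(1,2) order_refl f(3)] by metis
    from G(3)[OF b(1)] obtain a where a: "\<And>k g. g \<in> G \<Longrightarrow> a k g \<in> A"
      "\<And>k. b k = (\<Sum>g\<in>G. a k g * g)" by metis
    have "y = (\<Sum>k<degree f. \<Sum>g\<in>G. a k g * (g * x ^ k))"
      unfolding b(2) a(2) by (simp add: sum_distrib_right sum_distrib_left mult_ac)
    also have "\<dots> = (\<Sum>g\<in>G. \<Sum>k<degree f. a k g * (g * x ^ k))" by (rule sum.swap)
    also have "\<dots> = (\<Sum>j\<in>G \<times> {..<degree f}. (\<lambda>(g, k). a k g) j * (\<lambda>(g, i). g * x ^ i) j)"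
      by (simp add: sum.cartesian_product split_def)
    finally show "\<exists>a. (\<forall>j\<in>G \<times> {..<degree f}. a j \<in> A) \<and>
        y = (\<Sum>j\<in>G \<times> {..<degree f}. a j * (\<lambda>(g, i). g * x ^ i) j)"
      using a(1) by (intro exI[of _ "\<lambda>(g, k). a k g"]) auto
  qed
qed

lemma integral_over_mono: "A \<subseteq> B \<Longrightarrow> integral_over A x \<Longrightarrow> integral_over B x"
  unfolding integral_over_def polys_over_def by blast

text \<open>The elements of \<open>T\<close> are adjoined one at a time. This serves to replace
  \<open>B\<close> by a module-finite subring containing the finitely many coefficients of a given
  polynomial.\<close>

lemma integral_elements_in_module_finite:
  assumes A: "unital_subring A" and B: "unital_subring B" "A \<subseteq> B"
    and "finite T" "T \<subseteq> B" "\<And>x. x \<in> T \<Longrightarrow> integral_over A x"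
  shows "\<exists>S. unital_subring S \<and> A \<subseteq> S \<and> S \<subseteq> B \<and> T \<subseteq> S \<and> module_finite A S"
  using assms(4-)
proof (induction T rule: finite_induct)
  case empty
  have "module_finite A A"
    by (rule module_finiteI[of _ "{()}" "\<lambda>_. 1"])
      (use unital_subring_1[OF A] A in \<open>auto intro: exI[of _ "\<lambda>_. s" for s]\<close>)
  with A B show ?case by blast
next
  case (insert x T)
  then obtain S where S: "unital_subring S" "A \<subseteq> S" "S \<subseteq> B" "T \<subseteq> S" "module_finite A S"
    by auto
  have "module_finite A (adjoin S x)"
    using insert.prems integral_over_mono[OF S(2)] by (intro module_finite_adjoin A S) auto
  moreover have "adjoin S x \<subseteq> B"
    using insert.prems S by (intro adjoin_subset B) auto
  ultimately show ?case
    using S adjoin_subring[OF S(1)] subset_adjoin[OF S(1), of x] mem_adjoin[OF S(1), of x]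
    by (intro exI[of _ "adjoin S x"]) auto
qed

text \<open>The entries of the characteristic matrix lie in the unital subring
  \<open>polys_over A\<close>, which therefore contains its determinant.\<close>

lemma char_poly_polys_over:
  assumes A: "unital_subring A" and M: "M \<in> carrier_mat n n"
    and mem: "\<And>i j. i < n \<Longrightarrow> j < n \<Longrightarrow> M $$ (i, j) \<in> A"
  shows "char_poly M \<in> polys_over A"
  unfolding char_poly_def
proof (rule unital_subring_det[OF unital_subring_polys_over[OF A]])
  show "char_poly_matrix M \<in> carrier_mat n n" using M by simp
  fix i j assume "i < n" "j < n"
  with M mem[of i j] unital_subring_closed[OF A]
  show "char_poly_matrix M $$ (i, j) \<in> polys_over A"
    by (auto simp: char_poly_matrix_def polys_over_def coeff_pCons split: nat.split)
qed

text \<open>The determinant trick: multiplication by \<open>x\<close> acts on the generators through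
  a matrix \<open>M\<close> over \<open>A\<close>, and the characteristic polynomial of
  \<open>M\<close> is a monic equation for \<open>x\<close>.\<close>

lemma module_finite_imp_integral:
  assumes A: "unital_subring A" and S: "unital_subring S" and fin: "module_finite A S"
    and x: "x \<in> S"
  shows "integral_over A x"
proof -
  obtain G where G: "finite G" "G \<subseteq> S"
    "\<And>s. s \<in> S \<Longrightarrow> \<exists>a. (\<forall>g\<in>G. a g \<in> A) \<and> s = (\<Sum>g\<in>G. a g * g)"
    using fin unfolding module_finite_def by blast
  define n where "n = card G"
  obtain h where h: "bij_betw h {0..<n} G"
    using ex_bij_betw_nat_finite[OF G(1)] n_def by blast
  have h_mem: "h i \<in> G" if "i < n" for i
    using h that by (auto simp: bij_betw_def)
  have gen: "\<exists>a. (\<forall>j<n. a j \<in> A) \<and> s = (\<Sum>j=0..<n. a j * h j)" if s: "s \<in> S" for s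
  proof -
    from G(3)[OF s] obtain a where a: "\<forall>g\<in>G. a g \<in> A" "s = (\<Sum>g\<in>G. a g * g)" by blast
    from a(2) have "s = (\<Sum>j=0..<n. a (h j) * h j)"
      using sum.reindex_bij_betw[OF h, of "\<lambda>g. a g * g"] by simp
    with a(1) h_mem show ?thesis by (intro exI[of _ "\<lambda>j. a (h j)"]) auto
  qed
  have "x * h i \<in> S" if "i < n" for i
    using h_mem[OF that] G(2) x by (auto intro: unital_subring_mult[OF S])
  with gen have "\<forall>i. i < n \<longrightarrow> (\<exists>a. (\<forall>j<n. a j \<in> A) \<and> x * h i = (\<Sum>j=0..<n. a j * h j))" by blast
  then obtain m where m: "\<And>i j. i < n \<Longrightarrow> j < n \<Longrightarrow> m i j \<in> A"
    "\<And>i. i < n \<Longrightarrow> x * h i = (\<Sum>j=0..<n. m i j * h j)" by metis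
  define M where "M = mat n n (\<lambda>(i, j). m i j)"
  define N where "N = mat n n (\<lambda>(i, j). (if i = j then x else 0) - m i j)"
  define v where "v = vec n h"
  have M: "M \<in> carrier_mat n n" and N: "N \<in> carrier_mat n n" and v: "v \<in> carrier_vec n"
    by (auto simp: M_def N_def v_def)
  have eval: "poly (char_poly M) x = det N"
    unfolding char_poly_def
    by (rule poly_det_cong[OF N]) (use M in \<open>auto simp: M_def N_def char_poly_matrix_def\<close>)
  have "N *\<^sub>v v = 0\<^sub>v n"
  proof (rule eq_vecI)
    fix i assume "i < dim_vec (0\<^sub>v n :: 'a vec)"
    then have i: "i < n" by simp
    then have "(N *\<^sub>v v) $ i = (\<Sum>j=0..<n. (if i = j then x * h j else 0) - m i j * h j)"
      by (auto simp: N_def v_def scalar_prod_def left_diff_distrib intro!: sum.cong)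
    also have "\<dots> = 0"
      using i by (simp add: sum_subtractf m(2)[symmetric])
    finally show "(N *\<^sub>v v) $ i = 0\<^sub>v n $ i" using i by simp
  qed (simp add: N_def)
  \<comment> \<open>The adjugate turns \<open>N\<close> into the scalar \<open>det N\<close>, which
    thus annihilates every generator, and hence also 1, a combination of generators.\<close>
  then have "adj_mat N *\<^sub>v (N *\<^sub>v v) = 0\<^sub>v n"
    using adj_mat(1)[OF N] by auto
  then have "(adj_mat N * N) *\<^sub>v v = 0\<^sub>v n"
    using assoc_mult_mat_vec[OF adj_mat(1)[OF N] N v] by simp
  then have zero: "(det N \<cdot>\<^sub>m 1\<^sub>m n) *\<^sub>v v = 0\<^sub>v n"
    unfolding adj_mat(3)[OF N] .
  have det_h: "det N * h j = 0" if j: "j < n" for j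
  proof -
    have "((det N \<cdot>\<^sub>m 1\<^sub>m n) *\<^sub>v v) $ j = (\<Sum>i=0..<n. if i = j then det N * h i else 0)"
      using j by (auto simp: v_def scalar_prod_def if_distrib if_distribR cong: if_cong intro!: sum.cong)
    with zero j show ?thesis by simp
  qed
  obtain a where one: "(1::'a) = (\<Sum>j=0..<n. a j * h j)"
    using gen[OF unital_subring_1[OF S]] by blast
  have "det N * 1 = (\<Sum>j=0..<n. a j * (det N * h j))"
    unfolding one by (simp add: sum_distrib_left mult_ac)
  also have "\<dots> = 0" using det_h by simp
  finally have "poly (char_poly M) x = 0" using eval by simp
  moreover have "char_poly M \<in> polys_over A"
    by (rule char_poly_polys_over[OF A M]) (simp add: M_def m(1))
  ultimately show ?thesis
    unfolding integral_over_def using degree_monic_char_poly[OF M] by blast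
qed

text \<open>The coefficients of an equation for \<open>c\<close> lie in a subring \<open>S\<close>
  module-finite over \<open>A\<close>; adjoining \<open>c\<close> to \<open>S\<close> keeps it
  module-finite.\<close>

lemma integral_over_trans:
  assumes AB: "integral_extension A B" and c: "integral_over B c"
  shows "integral_over A c"
proof -
  obtain f where f: "f \<in> polys_over B" "lead_coeff f = 1" "poly f c = 0"
    using c unfolding integral_over_def by blast
  have "\<exists>S. unital_subring S \<and> A \<subseteq> S \<and> S \<subseteq> B \<and> coeff f ` {..degree f} \<subseteq> S \<and> module_finite A S"
    using AB f(1) unfolding integral_extension_def
    by (intro integral_elements_in_module_finite) (auto simp: polys_over_def)
  then obtain S where S: "unital_subring S" "module_finite A S" "coeff f ` {..degree f} \<subseteq> S"
    by blast
  have "coeff f i \<in> S" for i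
    using S(3) unital_subring_0[OF S(1)] by (cases "i \<le> degree f") (auto simp: coeff_eq_0)
  with f have "integral_over S c"
    unfolding integral_over_def by (intro bexI[of _ f]) (auto simp: polys_over_def)
  with AB S show ?thesis
    unfolding integral_extension_def
    by (intro module_finite_imp_integral[of A "adjoin S c"] module_finite_adjoin adjoin_subring mem_adjoin) auto
qed

subsection \<open>Annihilating polynomials over finite rings\<close>

lemma adjoin_finite:
  assumes S: "unital_subring S" "finite S"
    and g: "g \<in> polys_over S" "lead_coeff g = 1" "degree g \<le> d" "poly g x = 0"
  shows "finite (adjoin S x)" "card (adjoin S x) \<le> card S ^ d"
proof -
  let ?F = "{..<d} \<rightarrow>\<^sub>E S"
  have "adjoin S x \<subseteq> (\<lambda>a. \<Sum>k<d. a k * x ^ k) ` ?F"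
  proof
    fix y assume "y \<in> adjoin S x"
    then obtain a where a: "\<And>k. a k \<in> S" "y = (\<Sum>k<d. a k * x ^ k)"
      using adjoin_eq_combinations[OF S(1) g] by metis
    then show "y \<in> (\<lambda>a. \<Sum>k<d. a k * x ^ k) ` ?F"
      by (intro image_eqI[of _ _ "restrict a {..<d}"]) auto
  qed
  moreover have F: "finite ?F" "card ?F = card S ^ d"
    using S(2) by (auto simp: finite_PiE card_PiE)
  ultimately show "finite (adjoin S x)" "card (adjoin S x) \<le> card S ^ d"
    using finite_surj[OF F(1)] surj_card_le[OF F(1)] by (simp_all only: F(2))
qed

lemma module_finite_imp_finite:
  assumes "finite A" "module_finite A S"
  shows "finite S"
proof -
  obtain G where G: "finite G" "\<And>s. s \<in> S \<Longrightarrow> \<exists>a. (\<forall>g\<in>G. a g \<in> A) \<and> s = (\<Sum>g\<in>G. a g * g)"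
    using assms(2) unfolding module_finite_def by blast
  have "S \<subseteq> (\<lambda>a. \<Sum>g\<in>G. a g * g) ` (G \<rightarrow>\<^sub>E A)"
  proof
    fix s assume "s \<in> S"
    with G(2) obtain a where "\<forall>g\<in>G. a g \<in> A" "s = (\<Sum>g\<in>G. a g * g)" by blast
    then show "s \<in> (\<lambda>a. \<Sum>g\<in>G. a g * g) ` (G \<rightarrow>\<^sub>E A)"
      by (intro image_eqI[of _ _ "restrict a G"]) auto
  qed
  then show ?thesis
    by (rule finite_surj[rotated]) (use G(1) assms(1) in \<open>auto intro: finite_PiE\<close>)
qed

text \<open>Multiplication by \<open>x\<close> is injective on the finite set \<open>E\<close>,
  hence surjective, and so reaches 1.\<close>

lemma finite_subring_inverse:
  fixes E :: "'a::idom set"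
  assumes E: "unital_subring E" "finite E" and x: "x \<in> E" "x \<noteq> 0"
  shows "\<exists>y\<in>E. x * y = 1"
proof -
  have "inj_on ((*) x) E" using x by (auto simp: inj_on_def)
  moreover have "(*) x ` E \<subseteq> E" using x unital_subring_mult[OF E(1)] by auto
  ultimately have "(*) x ` E = E" using endo_inj_surj E(2) by blast
  with unital_subring_1[OF E(1)] show ?thesis by (metis imageE)
qed

lemma finite_subring_generator:
  fixes E :: "'a::idom set"
  assumes E: "unital_subring E" "finite E"
  obtains x where "x \<in> E" "\<And>y. y \<in> E \<Longrightarrow> y \<noteq> 0 \<Longrightarrow> \<exists>i::nat. y = x ^ i"
proof -
  \<comment> \<open>\<open>E\<close> is packaged as a ring with explicit carrier in order to apply
    the theorem that the unit group of a finite field is cyclic.\<close>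
  define R :: "'a ring" where "R = \<lparr>carrier = E, monoid.mult = (*), one = 1, ring.zero = 0, add = (+)\<rparr>"
  note closed = unital_subring_closed[OF E(1)]
  have "\<exists>y\<in>E. x + y = 0" if "x \<in> E" for x
    using that by (intro bexI[of _ "- x"]) (auto intro: closed)
  then interpret R: cring R
    by unfold_locales (auto simp: R_def algebra_simps Units_def intro: closed)
  interpret R: Ring.field R
    by (rule R.cring_fieldI2) (use finite_subring_inverse[OF E] in \<open>auto simp: R_def\<close>)
  have "finite (carrier R)" using E by (simp add: R_def)
  from R.finite_field_mult_group_has_gen[OF this]
  obtain x where x: "x \<in> carrier (mult_of R)"
    "carrier (mult_of R) = {x [^]\<^bsub>R\<^esub> i | i::nat. i \<in> UNIV}"
    by auto
  have "x [^]\<^bsub>R\<^esub> i = x ^ i" for i :: nat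
    by (induction i) (simp_all add: R_def mult.commute)
  with x that[of x] show ?thesis
    by (auto simp: R_def)
qed

lemma annihilator_finite:
  fixes B :: "'a::idom set"
  assumes AB: "integral_extension A B" and fin: "finite A"
    and w: "w \<in> polys_over B" "lead_coeff w = 1" "degree w = n" "poly w c = 0"
    and d: "\<And>b. b \<in> B \<Longrightarrow> \<exists>g\<in>polys_over A. lead_coeff g = 1 \<and> degree g \<le> d \<and> poly g b = 0"
  shows "\<exists>p\<in>polys_over A. p \<noteq> 0 \<and> degree p \<le> n * d \<and> poly p c = 0"
proof -
  have A: "unital_subring A" using AB by (simp add: integral_extension_def)
  have "\<exists>S. unital_subring S \<and> A \<subseteq> S \<and> S \<subseteq> B \<and> coeff w ` {..degree w} \<subseteq> S \<and> module_finite A S"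
    using AB w(1) unfolding integral_extension_def
    by (intro integral_elements_in_module_finite) (auto simp: polys_over_def)
  then obtain E where E: "unital_subring E" "A \<subseteq> E" "E \<subseteq> B" "module_finite A E"
    "coeff w ` {..degree w} \<subseteq> E"
    by blast
  have finE: "finite E" using module_finite_imp_finite[OF fin E(4)] .
  have "coeff w i \<in> E" for i
    using E(5) unital_subring_0[OF E(1)] by (cases "i \<le> degree w") (auto simp: coeff_eq_0)
  then have wE: "w \<in> polys_over E" by (simp add: polys_over_def)
  obtain x where x: "x \<in> E" "\<And>y. y \<in> E \<Longrightarrow> y \<noteq> 0 \<Longrightarrow> \<exists>i::nat. y = x ^ i"
    using finite_subring_generator[OF E(1) finE] by blast
  have "E \<subseteq> adjoin A x"
  proof
    fix y assume "y \<in> E"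
    then show "y \<in> adjoin A x"
      using x(2)[of y] unital_subring_0[OF adjoin_subring[OF A]]
        unital_subring_power[OF adjoin_subring[OF A] mem_adjoin[OF A]]
      by (cases "y = 0") auto
  qed
  moreover obtain g where "g \<in> polys_over A" "lead_coeff g = 1" "degree g \<le> d" "poly g x = 0"
    using d[of x] x E by blast
  note card_x = adjoin_finite[OF A fin this]
  ultimately have cardE: "card E \<le> card A ^ d"
    using card_x card_mono order_trans by blast
  note Ec = adjoin_finite[OF E(1) finE wE w(2) eq_imp_le[OF w(3)] w(4)]
  have card_A: "card A \<ge> 2"
    using card_mono[OF fin, of "{0, 1}"] unital_subring_0[OF A] unital_subring_1[OF A] by simp
  let ?F = "{..n * d} \<rightarrow>\<^sub>E A" and ?ev = "\<lambda>a. \<Sum>k\<le>n * d. a k * c ^ k"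
  have "card (adjoin E c) \<le> card A ^ (d * n)"
    using Ec(2) power_mono[OF cardE, of n] by (simp add: power_mult)
  \<comment> \<open>The strict inequality needs at least two elements in \<open>A\<close>. The
    exponent \<open>Suc (n * d)\<close> counts the coefficients of a polynomial of degree at most
    \<open>n * d\<close>.\<close>
  also have "\<dots> < card A ^ Suc (n * d)"
    using card_A by (simp add: mult.commute)
  also have "\<dots> = card ?F"
    using fin by (simp add: card_PiE)
  finally have less: "card (adjoin E c) < card ?F" .
  have ev: "?ev ` ?F \<subseteq> adjoin E c"
    using subset_adjoin[OF E(1), of c] E(2) mem_adjoin[OF E(1), of c]
    by (auto intro!: unital_subring_sum unital_subring_mult unital_subring_power adjoin_subring E(1))
  \<comment> \<open>Pigeonhole: two different coefficient tuples have the same value at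
    \<open>c\<close>, and their difference is the polynomial sought.\<close>
  have "\<not> inj_on ?ev ?F"
  proof
    assume "inj_on ?ev ?F"
    from card_inj_on_le[OF this ev Ec(1)] less show False by simp
  qed
  then obtain a b where ab: "a \<in> ?F" "b \<in> ?F" "a \<noteq> b" "?ev a = ?ev b"
    by (auto simp: inj_on_def)
  define p where "p = (\<Sum>k\<le>n * d. Polynomial.monom (a k - b k) k)"
  have coeff_p: "coeff p k = (if k \<le> n * d then a k - b k else 0)" for k
    by (simp add: p_def coeff_sum)
  have "p \<in> polys_over A"
    using ab(1,2) by (auto simp: polys_over_def coeff_p intro!: unital_subring_closed[OF A])
  moreover have "p \<noteq> 0"
  proof
    assume "p = 0"
    then have "a k = b k" if "k \<le> n * d" for k
      using coeff_p[of k] that by simp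
    then have "a = b" by (intro PiE_ext[OF ab(1,2)]) simp
    with ab(3) show False by simp
  qed
  moreover have "degree p \<le> n * d"
    by (intro degree_le) (auto simp: coeff_p)
  moreover have "poly p c = 0"
    using ab(4) by (simp add: p_def poly_sum poly_monom left_diff_distrib sum_subtractf)
  ultimately show ?thesis by blast
qed

subsection \<open>Descent to integrally closed rings\<close>

lemma polys_over_image:
  assumes A: "0 \<in> A" and f: "f 0 = 0" and p: "p \<in> polys_over (f ` A)"
  obtains q where "q \<in> polys_over A" "map_poly f q = p"
proof -
  from p have "\<exists>a\<in>A. f a = coeff p i" for i
    by (auto simp: polys_over_def image_iff) metis
  then obtain a where a: "\<And>i. a i \<in> A" "\<And>i. f (a i) = coeff p i" by metis
  \<comment> \<open>The chosen preimages of zero may be nonzero, so they are cut off beyond the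
    degree of \<open>p\<close>.\<close>
  define q where "q = (\<Sum>i\<le>degree p. Polynomial.monom (a i) i)"
  have q: "coeff q i = (if i \<le> degree p then a i else 0)" for i
    by (simp add: q_def coeff_sum)
  show ?thesis
  proof
    show "q \<in> polys_over A" using a A by (simp add: polys_over_def q)
    show "map_poly f q = p"
      by (rule poly_eqI) (simp add: coeff_map_poly f q a coeff_eq_0)
  qed
qed

lemma map_poly_polys_over:
  assumes "f 0 = 0" "p \<in> polys_over A"
  shows "map_poly f p \<in> polys_over (f ` A)"
  using assms by (auto simp: polys_over_def coeff_map_poly)

lemma unital_subring_image:
  assumes "comm_ring_hom f" "unital_subring A"
  shows "unital_subring (f ` A)"
proof -
  interpret comm_ring_hom f by fact
  from assms(2) show ?thesis
    unfolding unital_subring_def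
    by (auto simp flip: hom_minus hom_mult intro!: imageI) (metis hom_one imageI)
qed

lemma integral_over_image_iff:
  fixes f :: "'a::idom \<Rightarrow> 'b::idom"
  assumes f: "inj_comm_ring_hom f" and A: "0 \<in> A"
  shows "integral_over (f ` A) (f x) \<longleftrightarrow> integral_over A x"
proof -
  interpret f: inj_comm_ring_hom f by fact
  show ?thesis
  proof
    assume "integral_over (f ` A) (f x)"
    then obtain p where p: "p \<in> polys_over (f ` A)" "lead_coeff p = 1" "poly p (f x) = 0"
      unfolding integral_over_def by blast
    obtain q where q: "q \<in> polys_over A" "map_poly f q = p"
      using polys_over_image[OF A f.hom_zero p(1)] .
    from p(2,3) q(2) have "f (lead_coeff q) = f 1" "f (poly q x) = f 0"
      by auto
    then show "integral_over A x"
      using q(1) unfolding integral_over_def f.eq_iff by auto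
  next
    assume "integral_over A x"
    then obtain p where p: "p \<in> polys_over A" "lead_coeff p = 1" "poly p x = 0"
      unfolding integral_over_def by blast
    then show "integral_over (f ` A) (f x)"
      unfolding integral_over_def
      by (intro bexI[of _ "map_poly f p"] map_poly_polys_over) auto
  qed
qed

text \<open>An annihilator \<open>p\<close> of minimal degree divides a scalar multiple of a monic
  equation \<open>f\<close> of \<open>c\<close>. Its roots in an algebraic closure are therefore
  integral, and so are the coefficients of \<open>p\<close> divided by its leading coefficient
  \<open>l\<close>. Being fractions over \<open>A\<close>, these quotients lie in
  \<open>A\<close>.\<close>

lemma monic_annihilator_of_integrally_closed:
  fixes A :: "'a::idom set"
  assumes A: "unital_subring A" "integrally_closed A" and c: "integral_over A c"
    and p0: "p0 \<in> polys_over A" "p0 \<noteq> 0" "poly p0 c = 0"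
  shows "\<exists>q\<in>polys_over A. lead_coeff q = 1 \<and> degree q \<le> degree p0 \<and> poly q c = 0"
proof -
  let ?P = "\<lambda>p. p \<in> polys_over A \<and> p \<noteq> 0 \<and> poly p c = 0"
  obtain p where p: "?P p" and min: "\<And>p'. ?P p' \<Longrightarrow> degree p \<le> degree p'"
    using ex_has_least_nat[of ?P p0 degree] p0 by blast
  obtain f where f: "f \<in> polys_over A" "lead_coeff f = 1" "poly f c = 0"
    using c unfolding integral_over_def by blast
  define l where "l = lead_coeff p"
  have l: "l \<noteq> 0" "l \<in> A" using p by (auto simp: l_def polys_over_def)
  obtain k q r where qr: "q \<in> polys_over A" "r \<in> polys_over A" "smult (l ^ k) f = p * q + r"
    "r = 0 \<or> degree r < degree p"
    using pseudo_division_polys_over[OF A(1) _ _ f(1), of p] p unfolding l_def by blast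
  have "poly r c = 0"
    using arg_cong[OF qr(3), of "\<lambda>q. poly q c"] p f(3) by simp
  \<comment> \<open>A nonzero remainder would be an annihilator of smaller degree.\<close>
  then have "r = 0" using min[of r] qr by force
  with qr have dvd: "smult (l ^ k) f = p * q" by simp

  define \<phi> :: "'a \<Rightarrow> 'a fract alg_closure" where "\<phi> x = to_ac (to_fract x)" for x
  interpret to_ac: inj_comm_ring_hom "to_ac :: 'a fract \<Rightarrow> 'a fract alg_closure"
    by unfold_locales auto
  interpret \<phi>: inj_comm_ring_hom \<phi>
    by unfold_locales (auto simp: \<phi>_def)
  interpret \<phi>_poly: map_poly_inj_comm_ring_hom \<phi> ..
  have A': "unital_subring (\<phi> ` A)"
    by (rule unital_subring_image) (fact \<phi>.comm_ring_hom_axioms A(1))+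
  define \<mu> where "\<mu> = map_poly \<phi> p"
  have \<mu>: "\<mu> \<noteq> 0" "lead_coeff \<mu> = \<phi> l" using p by (auto simp: \<mu>_def l_def)
  obtain R where R: "\<mu> = smult (\<phi> l) (\<Prod>x\<in>#R. [:- x, 1:])"
    using alg_closed_imp_factorization[OF \<mu>(1)] \<mu>(2) by metis
  define \<nu> where "\<nu> = (\<Prod>x\<in>#R. [:- x, 1:])"
  have int_root: "integral_over (\<phi> ` A) x" if x: "x \<in># R" for x
  proof -
    have "poly \<nu> x = 0" using x unfolding \<nu>_def by (induction R) auto
    then have "poly \<mu> x = 0" by (simp add: R \<nu>_def)
    moreover have "smult (\<phi> l ^ k) (map_poly \<phi> f) = \<mu> * map_poly \<phi> q"
      using arg_cong[OF dvd, of "map_poly \<phi>"] by (simp add: \<mu>_def \<phi>_poly.hom_mult hom_distribs)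
    ultimately have "\<phi> l ^ k * poly (map_poly \<phi> f) x = 0"
      by (metis mult_zero_left poly_mult poly_smult)
    then have "poly (map_poly \<phi> f) x = 0" using l by simp
    then show ?thesis
      unfolding integral_over_def using f
      by (intro bexI[of _ "map_poly \<phi> f"] map_poly_polys_over) auto
  qed
  \<comment> \<open>One module-finite ring contains all the roots. The coefficients of
    \<open>\<nu>\<close> are sums of products of roots up to sign, so they lie in it too and are
    integral.\<close>
  obtain S where S: "unital_subring S" "\<phi> ` A \<subseteq> S" "set_mset R \<subseteq> S" "module_finite (\<phi> ` A) S"
    using integral_elements_in_module_finite[OF A', of UNIV "set_mset R"] int_root
    by (auto simp: unital_subring_def)
  have \<nu>: "\<nu> \<in> polys_over S"
    using S(3) unfolding \<nu>_def
    by (induction R) (auto intro!: unital_subring_closed[OF unital_subring_polys_over[OF S(1)]]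
      pCons_polys_over unital_subring_closed S(1) simp del: mult_pCons_left)
  have "\<exists>a\<in>A. l * a = coeff p i" for i
  proof -
    have "integral_over (\<phi> ` A) (coeff \<nu> i)"
      using \<nu> by (intro module_finite_imp_integral[OF A' S(1,4)]) (auto simp: polys_over_def)
    moreover have "\<phi> (coeff p i) = \<phi> l * coeff \<nu> i"
      using arg_cong[OF R, of "\<lambda>q. coeff q i"] by (simp add: \<mu>_def \<nu>_def)
    then have "coeff \<nu> i = to_ac (Fract (coeff p i) l)"
      using l by (simp add: Fract_conv_to_fract \<phi>_def field_simps)
    moreover have "\<phi> ` A = to_ac ` to_fract ` A"
      by (auto simp: \<phi>_def image_image)
    ultimately have "integral_over (to_fract ` A) (Fract (coeff p i) l)"
      using integral_over_image_iff[OF to_ac.inj_comm_ring_hom_axioms, of "to_fract ` A"]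
        unital_subring_0[OF A(1)] by (metis imageI to_fract_0)
    moreover have "Fract (coeff p i) l \<in> fraction_field A"
      using p l by (auto simp: fraction_field_def polys_over_def)
    ultimately obtain a where "a \<in> A" "Fract (coeff p i) l = to_fract a"
      using A(2) unfolding integrally_closed_def by blast
    then have "to_fract (l * a) = to_fract (coeff p i)"
      using l by (simp add: Fract_conv_to_fract field_simps)
    with \<open>a \<in> A\<close> show ?thesis unfolding to_fract_eq_iff by blast
  qed
  \<comment> \<open>Division of \<open>p\<close> by \<open>l\<close> within \<open>A\<close> is done
    by lifting its coefficients along multiplication by \<open>l\<close>.\<close>
  then have p': "p \<in> polys_over ((*) l ` A)"
    by (auto simp: polys_over_def image_iff) metis
  obtain q' where q': "q' \<in> polys_over A" "map_poly ((*) l) q' = p"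
    using polys_over_image[OF unital_subring_0[OF A(1)] mult_zero_right p'] .
  then have pq': "p = smult l q'"
    by (simp add: smult_conv_map_poly)
  with l have "lead_coeff q' = 1" unfolding l_def
    by (metis lead_coeff_smult mult_cancel_left1)
  moreover have "poly q' c = 0" using p pq' l by simp
  moreover have "degree q' \<le> degree p0" using min[of p0] p0 pq' l by simp
  ultimately show ?thesis using q' by blast
qed

subsection \<open>Integral degrees\<close>

text \<open>A monic constant is 1 and has no root. This supplies the bound \<open>n \<ge> 1\<close>
  in \<open>integral_degree\<close>.\<close>

lemma monic_root_degree_nonzero:
  fixes p :: "'a::comm_ring_1 poly"
  assumes "lead_coeff p = 1" "poly p x = 0"
  shows "degree p \<noteq> 0"
proof
  assume "degree p = 0"
  then obtain a where "p = [:a:]" by (rule degree_eq_zeroE)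
  with assms show False by simp
qed

lemma integral_degree_witness:
  assumes "integral_over A b"
  shows "integral_degree A b \<ge> 1 \<and>
    (\<exists>p\<in>polys_over A. lead_coeff p = 1 \<and> degree p = integral_degree A b \<and> poly p b = 0)"
proof -
  obtain p where p: "p \<in> polys_over A" "lead_coeff p = 1" "poly p b = 0"
    using assms unfolding integral_over_def by blast
  then have "degree p \<ge> 1 \<and>
      (\<exists>q\<in>polys_over A. lead_coeff q = 1 \<and> degree q = degree p \<and> poly q b = 0)"
    using monic_root_degree_nonzero[OF p(2,3)] by auto
  then show ?thesis
    unfolding integral_degree_def by (rule LeastI)
qed

lemma integral_degree_le:
  assumes p: "p \<in> polys_over A" "lead_coeff p = 1" "poly p b = 0"
  shows "integral_degree A b \<le> degree p"
proof -
  have "degree p \<ge> 1 \<and>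
      (\<exists>q\<in>polys_over A. lead_coeff q = 1 \<and> degree q = degree p \<and> poly q b = 0)"
    using monic_root_degree_nonzero[OF p(2,3)] p by auto
  then show ?thesis
    unfolding integral_degree_def by (rule Least_le)
qed

theorem corollary6p7:
  fixes A B C :: "'a::idom set"
  assumes "integral_extension A B"
    and "integral_extension B C"
    and "integrally_closed A"
  shows "ext_degree A C \<le> ext_degree A B * ext_degree B C"
proof (cases "ext_degree A B")
  case (enat d)
  note AB = assms(1) and BC = assms(2)
  have A: "unital_subring A" and B: "unital_subring B" and sub: "A \<subseteq> B"
    using AB by (auto simp: integral_extension_def)
  have witness: "\<exists>g\<in>polys_over A. lead_coeff g = 1 \<and> degree g \<le> d \<and> poly g b = 0"
    if b: "b \<in> B" for b
  proof -
    have "enat (integral_degree A b) \<le> ext_degree A B"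
      unfolding ext_degree_def using b by (rule SUP_upper)
    then have "integral_degree A b \<le> d" by (simp add: enat)
    moreover have "integral_over A b" using AB b by (simp add: integral_extension_def)
    ultimately show ?thesis
      using integral_degree_witness[of A b] by metis
  qed
  show ?thesis
    unfolding ext_degree_def[of A C]
  proof (rule SUP_least)
    fix c assume c: "c \<in> C"
    then have int: "integral_over B c" using BC by (auto simp: integral_extension_def)
    \<comment> \<open>Only the degree of this particular \<open>c\<close> enters, so
      \<open>ext_degree B C\<close> may be infinite here.\<close>
    define n where "n = integral_degree B c"
    obtain w where w: "w \<in> polys_over B" "lead_coeff w = 1" "degree w = n" "poly w c = 0"
      using integral_degree_witness[OF int] unfolding n_def by blast
    have "\<exists>p\<in>polys_over A. p \<noteq> 0 \<and> degree p \<le> n * d \<and> poly p c = 0"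
    proof (cases "finite A")
      case True
      then show ?thesis using annihilator_finite[OF AB _ w] witness by blast
    next
      case False
      have "w \<noteq> 0" using w(2) by auto
      moreover have "poly w t \<in> B" if "t \<in> A" for t
        using poly_mem_unital_subring[OF B w(1)] sub that by blast
      ultimately show ?thesis
        using annihilator_infinite[OF A False _ w(3,4) witness] by blast
    qed
    then obtain q where "q \<in> polys_over A" "lead_coeff q = 1" "degree q \<le> n * d" "poly q c = 0"
      using monic_annihilator_of_integrally_closed[OF A assms(3) integral_over_trans[OF AB int]]
      by (meson order_trans)
    then have "integral_degree A c \<le> d * n"
      using integral_degree_le[of q A c] by (simp add: mult.commute)
    then have "enat (integral_degree A c) \<le> enat d * enat n" by simp
    also have "\<dots> \<le> ext_degree A B * ext_degree B C"
      unfolding enat n_def ext_degree_def[of B C]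
      by (intro mult_left_mono SUP_upper c) auto
    finally show "enat (integral_degree A c) \<le> ext_degree A B * ext_degree B C" .
  qed
next
  case infinity
  \<comment> \<open>In \<open>enat\<close> the product of infinity and 0 is 0, so the second factor
    must be shown to be nonzero; the element 1 of \<open>C\<close> does this.\<close>
  have one: "1 \<in> C" and int: "integral_over B 1"
    using assms(2) by (auto simp: integral_extension_def unital_subring_def)
  have "enat (integral_degree B 1) \<le> ext_degree B C"
    unfolding ext_degree_def by (rule SUP_upper) fact
  moreover have "integral_degree B 1 \<ge> 1"
    using integral_degree_witness[OF int] by simp
  ultimately have "ext_degree B C \<noteq> 0"
    by (auto simp: zero_enat_def)
  with infinity have "ext_degree A B * ext_degree B C = \<infinity>"
    by (simp add: imult_is_infinity)
  then show ?thesis by simp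
qed

end
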